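(* Let $X,Y$ be real random variables with respective Stein operators $$A_X=a_1T_{\alpha_1}-a_2M^pT_{\alpha_2},\qquad A_Y=b_1T_{\beta_1}-b_2M^qT_{\beta_2},$$ where $a_1,a_2,b_1,b_2\in\mathbb R$, $p,q$ are positive integers and $\alpha_1,\alpha_2,\beta_1,\beta_2\in\mathbb R\cup\{\infty\}$ (with $T_\infty:=I$). Let $m$ be the least common multiple of $p$ and $q$, and write $m=k_1p=k_2q$. If $X$ and $Y$ are independent, then $$a_1^{k_1}b_1^{k_2}\prod_{i=0}^{k_1-1}T_{\alpha_1+ip}\prod_{i=0}^{k_2-1}T_{\beta_1+iq}-a_2^{k_1}b_2^{k_2}M^m\prod_{i=0}^{k_1-1}T_{\alpha_2+ip}\prod_{i=0}^{k_2-1}T_{\beta_2+iq}$$ is a Stein operator for $XY$.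
   Context: Notation: $Mf(x)=xf(x)$, $Df=f'$, $I$ is the identity, and $T_r=MD+rI$ for $r\in\mathbb R$, i.e. $T_rf(x)=xf'(x)+rf(x)$. Since $r^{-1}T_r\to I$ pointwise as $r\to\infty$, the convention is that a factor $T_r$ with infinite parameter is replaced by the identity: $T_\infty=I$, and $\infty+c=\infty$ for $c\in\mathbb R$. Products of operators are compositions (the $T_r$ commute with each other). Definition: a linear differential operator $A$ acting on a class $\mathcal F$ of functions is a Stein operator for a random variable $X$ if $Af\in L^1(X)$ (i.e. $\mathbb E|Af(X)|<\infty$) and $\mathbb E[Af(X)]=0$ for all $f\in\mathcal F$. Convention: Stein operators are understood to act on a class containing $C_0^\infty(\mathbb R)$, the smooth compactly supported functions on $\mathbb R$; thus "A is a Stein operator for $X$" means that $Af(X)$ is integrable with mean zero for every $f\in C_0^\infty(\mathbb R)$. Standing assumption: the random variables $X,Y$ each have a density with respect to Lebesgue measure that is smooth and non-vanishing on some (possibly unbounded) interval $J\subseteq\mathbb R$ (depending on the variable), which is its support. *)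

theory Defs
  imports "HOL-Probability.Probability"
begin

text \<open>Operators act on functions \<open>real \<Rightarrow> real\<close>; products of operators are compositions.\<close>

type_synonym operator = "(real \<Rightarrow> real) \<Rightarrow> real \<Rightarrow> real"

definition mult_op :: operator where
  "mult_op f = (\<lambda>x. x * f x)"

definition diff_op :: operator where
  "diff_op f = deriv f"

text \<open>
  \<open>T_r = M D + r I\<close>, with \<open>T_\<infinity> = I\<close>.  The parameter is an \<^typ>\<open>ereal\<close>, so that
  \<open>\<infinity> + c = \<infinity>\<close> for real \<open>c\<close> is the library's addition.  The value at \<open>-\<infinity>\<close> has no meaning;
  such parameters have to be excluded where \<open>T_op\<close> is used.
\<close>

definition T_op :: "ereal \<Rightarrow> operator" where
  "T_op r f = (if r = \<infinity> then f
     else (\<lambda>x. mult_op (diff_op f) x + real_of_ereal r * f x))"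

primrec op_prod :: "nat \<Rightarrow> (nat \<Rightarrow> operator) \<Rightarrow> operator" where
  "op_prod 0 F = id"
| "op_prod (Suc n) F = op_prod n F \<circ> F n"

text \<open>
  Smoothness on an \<^emph>\<open>open\<close> set: \<^const>\<open>deriv\<close> at a point of \<open>S\<close> only looks at \<open>f\<close> inside \<open>S\<close>.
\<close>

definition smooth_on :: "real set \<Rightarrow> (real \<Rightarrow> real) \<Rightarrow> bool" where
  "smooth_on S f \<longleftrightarrow> (\<forall>n. \<forall>x\<in>S. (deriv ^^ n) f differentiable (at x))"

definition C0_infinity :: "(real \<Rightarrow> real) set" where
  "C0_infinity = {f. smooth_on UNIV f \<and> compact (closure {x. f x \<noteq> 0})}"

definition stein_operator_on ::
    "(real \<Rightarrow> real) set \<Rightarrow> 'a measure \<Rightarrow> ('a \<Rightarrow> real) \<Rightarrow> operator \<Rightarrow> bool" where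
  "stein_operator_on \<F> P X A \<longleftrightarrow>
     (\<forall>f\<in>\<F>. integrable P (\<lambda>\<omega>. A f (X \<omega>)) \<and> (\<integral>\<omega>. A f (X \<omega>) \<partial>P) = 0)"

abbreviation stein_operator :: "'a measure \<Rightarrow> ('a \<Rightarrow> real) \<Rightarrow> operator \<Rightarrow> bool" where
  "stein_operator \<equiv> stein_operator_on C0_infinity"

text \<open>
  The interval \<open>J\<close> is taken to be open, which is the most permissive reading: end points are a null
  set, and a density that is smooth up to an end point is in particular smooth in the interior,
  while densities that are singular at an end point (beta, gamma) remain admissible.  Densities are
  determined only almost everywhere; \<open>d\<close> is a version that vanishes off \<open>J\<close>.
\<close>

definition smooth_density_on_interval :: "'a measure \<Rightarrow> ('a \<Rightarrow> real) \<Rightarrow> bool" where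
  "smooth_density_on_interval P X \<longleftrightarrow>
     (\<exists>J d. open J \<and> is_interval J \<and> smooth_on J d \<and>
        (\<forall>x\<in>J. d x > 0) \<and> (\<forall>x. x \<notin> J \<longrightarrow> d x = 0) \<and>
        distributed P lborel X (\<lambda>x. ennreal (d x)))"

end

theory Submission
  imports Defs
begin

text \<open>
  Iterating the two Stein equations brings them to the common power \<open>M^m\<close>.  One would like to
  apply the one for \<open>X\<close> to \<open>x \<mapsto> f(xy)\<close> and then the one for \<open>Y\<close>, using that the \<open>T_r\<close> commute
  with dilations, but the intermediate term carries \<open>X^m\<close> without \<open>Y^m\<close> and need not be
  integrable.  So \<open>f(xy)\<close> is replaced by \<open>f(xy) u(y/\<epsilon>)^m\<close> with \<open>u(z) = z^2/(1+z^2)\<close>: since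
  \<open>u(z) \<le> \<bar>z\<bar>\<close>, now \<open>x^m\<close> times the test function is bounded.  The operator \<open>z d/dz\<close> maps
  polynomials in \<open>u\<close> to polynomials in \<open>u\<close> vanishing at \<open>u = 1\<close>, so all terms
  are bounded uniformly in \<open>\<epsilon>\<close>, those in which the cutoff is differentiated vanish as \<open>\<epsilon> \<rightarrow> 0\<close>, and
  dominated convergence gives the claim.
\<close>

subsection \<open>Smooth functions\<close>

abbreviation smooth :: "(real \<Rightarrow> real) \<Rightarrow> bool" where
  "smooth \<equiv> smooth_on UNIV"

text \<open>Smoothness truncated at a finite order: the closure properties are proved by induction
  on \<open>n\<close>, each step consuming one derivative.\<close>

definition differentiable_upto :: "nat \<Rightarrow> (real \<Rightarrow> real) \<Rightarrow> bool" where
  "differentiable_upto n f \<longleftrightarrow> (\<forall>k\<le>n. \<forall>x. (deriv ^^ k) f differentiable (at x))"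

lemma smooth_iff_differentiable_upto: "smooth f \<longleftrightarrow> (\<forall>n. differentiable_upto n f)"
  unfolding smooth_on_def differentiable_upto_def by auto

lemma differentiable_upto_0: "differentiable_upto 0 f \<longleftrightarrow> (\<forall>x. f differentiable (at x))"
  unfolding differentiable_upto_def by auto

lemma differentiable_upto_Suc:
  "differentiable_upto (Suc n) f \<longleftrightarrow>
     (\<forall>x. f differentiable (at x)) \<and> differentiable_upto n (deriv f)"
proof -
  have "(\<forall>k\<le>Suc n. Q k) \<longleftrightarrow> Q 0 \<and> (\<forall>k\<le>n. Q (Suc k))" for Q
    by (metis Suc_le_mono not0_implies_Suc zero_le)
  from this[of "\<lambda>k. \<forall>x. (deriv ^^ k) f differentiable (at x)"] show ?thesis
    unfolding differentiable_upto_def by (simp add: funpow_Suc_right del: funpow.simps)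
qed

lemma differentiable_imp_DERIV_deriv:
  "f differentiable (at x) \<Longrightarrow> (f has_field_derivative deriv f x) (at x)" for x :: real
  using DERIV_deriv_iff_real_differentiable by blast

lemma differentiable_upto_differentiable:
  "differentiable_upto n f \<Longrightarrow> f differentiable (at x)"
  unfolding differentiable_upto_def by force

lemma differentiable_upto_DERIV:
  "differentiable_upto n f \<Longrightarrow> (f has_field_derivative deriv f x) (at x)"
  by (simp add: differentiable_imp_DERIV_deriv differentiable_upto_differentiable)

lemma differentiable_upto_mono:
  "differentiable_upto n f \<Longrightarrow> k \<le> n \<Longrightarrow> differentiable_upto k f"
  unfolding differentiable_upto_def by auto

lemma smooth_DERIV: "smooth f \<Longrightarrow> (f has_field_derivative deriv f x) (at x)"
  using differentiable_upto_DERIV smooth_iff_differentiable_upto by blast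

lemma smooth_deriv: "smooth f \<Longrightarrow> smooth (deriv f)"
  using differentiable_upto_Suc smooth_iff_differentiable_upto by blast

lemma differentiable_upto_const: "differentiable_upto n (\<lambda>_. c)"
proof (induction n arbitrary: c)
  case (Suc n)
  have "deriv (\<lambda>_. c) = (\<lambda>_. 0)" by auto
  with Suc show ?case by (simp add: differentiable_upto_Suc)
qed (simp add: differentiable_upto_0)

lemma differentiable_upto_ident: "differentiable_upto n (\<lambda>x. x)"
proof (cases n)
  case (Suc k)
  have "deriv (\<lambda>x::real. x) = (\<lambda>_. 1)" by auto
  with Suc show ?thesis by (simp add: differentiable_upto_Suc differentiable_upto_const)
qed (simp add: differentiable_upto_0)

lemma differentiable_upto_add:
  "differentiable_upto n f \<Longrightarrow> differentiable_upto n g \<Longrightarrow> differentiable_upto n (\<lambda>x. f x + g x)"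
proof (induction n arbitrary: f g)
  case (Suc n)
  have "deriv (\<lambda>x. f x + g x) = (\<lambda>x. deriv f x + deriv g x)"
    using Suc.prems by (intro ext DERIV_imp_deriv DERIV_add differentiable_upto_DERIV)
  with Suc show ?case by (simp add: differentiable_upto_Suc)
qed (simp add: differentiable_upto_0)

lemma differentiable_upto_mult:
  "differentiable_upto n f \<Longrightarrow> differentiable_upto n g \<Longrightarrow> differentiable_upto n (\<lambda>x. f x * g x)"
proof (induction n arbitrary: f g)
  case (Suc n)
  have "deriv (\<lambda>x. f x * g x) = (\<lambda>x. deriv f x * g x + deriv g x * f x)"
    using Suc.prems by (intro ext DERIV_imp_deriv DERIV_mult differentiable_upto_DERIV)
  \<comment> \<open>The product rule also leaves \<open>f\<close> and \<open>g\<close>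
    undifferentiated, so their order is lowered to \<open>n\<close> to fit the induction
    hypothesis.\<close>
  moreover have "differentiable_upto n f" "differentiable_upto n g"
    using Suc.prems differentiable_upto_mono le_SucI by blast+
  ultimately show ?case
    using Suc by (simp add: differentiable_upto_Suc differentiable_upto_add)
qed (simp add: differentiable_upto_0)

lemma smooth_const [intro]: "smooth (\<lambda>_. c)"
  and smooth_ident [intro]: "smooth (\<lambda>x. x)"
  and smooth_add [intro]: "smooth f \<Longrightarrow> smooth g \<Longrightarrow> smooth (\<lambda>x. f x + g x)"
  and smooth_mult [intro]: "smooth f \<Longrightarrow> smooth g \<Longrightarrow> smooth (\<lambda>x. f x * g x)"
  by (simp_all add: smooth_iff_differentiable_upto differentiable_upto_const
      differentiable_upto_ident differentiable_upto_add differentiable_upto_mult)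

lemma smooth_power [intro]: "smooth f \<Longrightarrow> smooth (\<lambda>x. f x ^ n)"
  by (induction n) auto

lemma DERIV_scale:
  assumes "smooth f"
  shows "((\<lambda>x. f (c * x)) has_field_derivative c * deriv f (c * x)) (at x)"
proof -
  have "((\<lambda>x. c * x) has_field_derivative c) (at x)"
    by (auto intro!: derivative_eq_intros)
  from DERIV_chain2[OF smooth_DERIV[OF assms] this] show ?thesis by (simp add: mult.commute)
qed

lemma smooth_scale:
  assumes "smooth f"
  shows "smooth (\<lambda>x. f (c * x))"
proof -
  \<comment> \<open>Generalised over \<open>g\<close>, because differentiating replaces
    \<open>g\<close> by \<open>deriv g\<close> inside the dilation.\<close>
  have "smooth g \<Longrightarrow> differentiable_upto n (\<lambda>x. g (c * x))" for n g
  proof (induction n arbitrary: g)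
    case 0
    then show ?case
      unfolding differentiable_upto_0 real_differentiable_def by (blast intro: DERIV_scale)
  next
    case (Suc n)
    have "deriv (\<lambda>x. g (c * x)) = (\<lambda>x. c * deriv g (c * x))"
      using Suc.prems by (intro ext DERIV_imp_deriv DERIV_scale)
    moreover have "\<forall>x. (\<lambda>x. g (c * x)) differentiable (at x)"
      unfolding real_differentiable_def using Suc.prems by (blast intro: DERIV_scale)
    moreover have "differentiable_upto n (\<lambda>x. deriv g (c * x))"
      using Suc by (blast intro: smooth_deriv)
    ultimately show ?case
      by (simp add: differentiable_upto_Suc differentiable_upto_mult differentiable_upto_const)
  qed
  with assms show ?thesis by (simp add: smooth_iff_differentiable_upto)
qed

lemma smooth_isCont: "smooth f \<Longrightarrow> isCont f x"
  using DERIV_isCont smooth_DERIV by blast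

lemma smooth_continuous_on: "smooth f \<Longrightarrow> continuous_on A f"
  by (simp add: continuous_at_imp_continuous_on smooth_isCont)

subsection \<open>The operators \<open>T_r\<close> and their products\<close>

lemma T_op_infinity [simp]: "T_op \<infinity> f = f"
  by (simp add: T_op_def)

lemma T_op_finite: "r \<noteq> \<infinity> \<Longrightarrow> T_op r f = (\<lambda>x. x * deriv f x + real_of_ereal r * f x)"
  by (simp add: T_op_def mult_op_def diff_op_def)

lemma smooth_T_op: "smooth f \<Longrightarrow> smooth (T_op r f)"
  by (cases "r = \<infinity>")
    (auto simp: T_op_finite intro!: smooth_add smooth_mult smooth_ident smooth_const smooth_deriv)

lemma T_op_add:
  assumes "smooth f" "smooth g"
  shows "T_op r (\<lambda>x. f x + g x) = (\<lambda>x. T_op r f x + T_op r g x)"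
proof -
  have "deriv (\<lambda>x. f x + g x) = (\<lambda>x. deriv f x + deriv g x)"
    using assms by (intro ext DERIV_imp_deriv DERIV_add smooth_DERIV)
  then show ?thesis by (cases "r = \<infinity>") (auto simp: T_op_finite algebra_simps)
qed

lemma T_op_cmult:
  assumes "smooth f"
  shows "T_op r (\<lambda>x. c * f x) = (\<lambda>x. c * T_op r f x)"
proof -
  have "deriv (\<lambda>x. c * f x) = (\<lambda>x. c * deriv f x)"
    using assms by (intro ext DERIV_imp_deriv DERIV_cmult smooth_DERIV)
  then show ?thesis by (cases "r = \<infinity>") (auto simp: T_op_finite algebra_simps)
qed

lemma T_op_scale:
  assumes "smooth f"
  shows "T_op r (\<lambda>x. f (c * x)) = (\<lambda>x. T_op r f (c * x))"
proof -
  have "deriv (\<lambda>x. f (c * x)) = (\<lambda>x. c * deriv f (c * x))"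
    using assms by (intro ext DERIV_imp_deriv DERIV_scale)
  then show ?thesis by (cases "r = \<infinity>") (auto simp: T_op_finite algebra_simps)
qed

text \<open>The zeroth-order term of \<open>T_r\<close> is attached to \<open>f\<close>, so
  \<open>g\<close> meets the bare Euler operator x d/dx. The identity, at
  \<open>r = \<infinity>\<close>, obeys no such Leibniz rule.\<close>

lemma T_op_mult:
  assumes "smooth f" "smooth g" "r \<noteq> \<infinity>"
  shows "T_op r (\<lambda>x. f x * g x) = (\<lambda>x. T_op r f x * g x + f x * (x * deriv g x))"
proof -
  have "deriv (\<lambda>x. f x * g x) = (\<lambda>x. deriv f x * g x + deriv g x * f x)"
    using assms by (intro ext DERIV_imp_deriv DERIV_mult smooth_DERIV)
  then show ?thesis using assms by (auto simp: T_op_finite algebra_simps)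
qed

text \<open>Each operator is the Euler operator MD plus a constant: for finite parameters both sides
  are x^2 f'' + (1 + r + s) x f' + r s f.\<close>

lemma T_op_commute:
  assumes "smooth f"
  shows "T_op r (T_op s f) = T_op s (T_op r f)"
proof (cases "r = \<infinity> \<or> s = \<infinity>")
  case False
  have "deriv (\<lambda>x. x * deriv f x + c * f x)
      = (\<lambda>x. deriv f x + x * deriv (deriv f) x + c * deriv f x)" for c
    using assms by (intro ext DERIV_imp_deriv)
      (auto intro!: derivative_eq_intros smooth_DERIV[OF assms] smooth_DERIV[OF smooth_deriv])
  with False show ?thesis by (simp add: T_op_finite) (simp add: algebra_simps)
qed auto

text \<open>Applying x d/dx to \<open>x ^ n\<close> gives \<open>n * x ^ n\<close>, hence the shift.
  It is absorbed at \<infinity>; at -\<infinity> the default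
  \<open>real_of_ereal (-\<infinity>) = 0\<close> would lose it.\<close>

lemma T_op_power_mult:
  assumes "smooth f" "r \<noteq> -\<infinity>"
  shows "T_op r (\<lambda>x. x ^ n * f x) = (\<lambda>x. x ^ n * T_op (r + ereal (real n)) f x)"
proof (cases r)
  case (real s)
  have "deriv (\<lambda>x. x ^ n * f x) = (\<lambda>x. real n * x ^ (n - 1) * f x + x ^ n * deriv f x)"
    using assms by (intro ext DERIV_imp_deriv)
      (auto intro!: derivative_eq_intros smooth_DERIV[OF assms(1)])
  then have "T_op r (\<lambda>x. x ^ n * f x) x = x ^ n * T_op (r + ereal (real n)) f x" for x
    \<comment> \<open>The case \<open>n = 0\<close> is split off because
      \<open>x * x ^ (n - 1) = x ^ n\<close> fails there under truncated subtraction.\<close>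
    using real by (cases n) (auto simp: T_op_finite algebra_simps)
  then show ?thesis by blast
qed (use assms in auto)

lemma mult_op_funpow: "(mult_op ^^ n) f = (\<lambda>x. x ^ n * f x)"
  by (induction n) (auto simp: mult_op_def)

section \<open>Smooth functions of compact support\<close>

lemma C0_infinity_iff: "f \<in> C0_infinity \<longleftrightarrow> smooth f \<and> (\<exists>K. \<forall>x. \<bar>x\<bar> > K \<longrightarrow> f x = 0)"
proof -
  have "compact (closure {x. f x \<noteq> 0}) \<longleftrightarrow> bounded {x. f x \<noteq> 0}"
    by (simp add: compact_closure)
  also have "\<dots> \<longleftrightarrow> (\<exists>K. \<forall>x. \<bar>x\<bar> > K \<longrightarrow> f x = 0)"
    unfolding bounded_iff by (simp) (metis not_le)
  finally show ?thesis by (simp add: C0_infinity_def)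
qed

lemma C0_infinity_smooth: "f \<in> C0_infinity \<Longrightarrow> smooth f"
  by (simp add: C0_infinity_iff)

lemma C0_infinity_add [intro]:
  assumes "f \<in> C0_infinity" "g \<in> C0_infinity"
  shows "(\<lambda>x. f x + g x) \<in> C0_infinity"
proof -
  obtain K L where "\<forall>x. \<bar>x\<bar> > K \<longrightarrow> f x = 0" "\<forall>x. \<bar>x\<bar> > L \<longrightarrow> g x = 0"
    using assms by (auto simp: C0_infinity_iff)
  then have "\<forall>x. \<bar>x\<bar> > max K L \<longrightarrow> f x + g x = 0" by simp
  with assms show ?thesis unfolding C0_infinity_iff by blast
qed

lemma C0_infinity_mult [intro]:
  assumes "f \<in> C0_infinity" "smooth g"
  shows "(\<lambda>x. f x * g x) \<in> C0_infinity" "(\<lambda>x. g x * f x) \<in> C0_infinity"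
  using assms unfolding C0_infinity_iff by (fastforce intro: smooth_mult)+

lemma C0_infinity_scale:
  assumes "f \<in> C0_infinity" "c \<noteq> 0"
  shows "(\<lambda>x. f (c * x)) \<in> C0_infinity"
proof -
  obtain K where K: "\<forall>x. \<bar>x\<bar> > K \<longrightarrow> f x = 0"
    using assms by (auto simp: C0_infinity_iff)
  have "f (c * x) = 0" if "\<bar>x\<bar> > K / \<bar>c\<bar>" for x
    using K that assms(2) by (auto simp: abs_mult field_simps)
  with assms smooth_scale show ?thesis unfolding C0_infinity_iff by blast
qed

lemma C0_infinity_T_op [intro]:
  assumes "f \<in> C0_infinity"
  shows "T_op r f \<in> C0_infinity"
proof -
  obtain K where K: "\<And>x. \<bar>x\<bar> > K \<Longrightarrow> f x = 0"
    using assms by (auto simp: C0_infinity_iff)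
  have "T_op r f x = 0" if x: "\<bar>x\<bar> > K" for x
  proof -
    \<comment> \<open>The exterior of the support interval is open, so \<open>f\<close> vanishes
      near \<open>x\<close> and its derivative at \<open>x\<close> is that of the zero
      function.\<close>
    have "open {x::real. \<bar>x\<bar> > K}" by (intro open_Collect_less continuous_intros)
    then have "eventually (\<lambda>y. y \<in> {x. \<bar>x\<bar> > K}) (nhds x)"
      using x by (intro eventually_nhds_in_open) auto
    then have "eventually (\<lambda>y. f y = (\<lambda>_. 0) y) (nhds x)"
      by eventually_elim (use K in auto)
    then have "deriv f x = deriv (\<lambda>_. 0) x" by (rule deriv_cong_ev) simp
    then show ?thesis using K[OF x] by (cases "r = \<infinity>") (auto simp: T_op_finite)
  qed
  with assms smooth_T_op show ?thesis unfolding C0_infinity_iff by blast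
qed

lemma C0_infinity_bounded:
  assumes "f \<in> C0_infinity"
  obtains C where "\<And>x. \<bar>f x\<bar> \<le> C"
proof -
  obtain K where K: "\<And>x. \<bar>x\<bar> > K \<Longrightarrow> f x = 0"
    using assms by (auto simp: C0_infinity_iff)
  have "compact (f ` {-K..K})"
    using assms by (intro compact_continuous_image smooth_continuous_on C0_infinity_smooth) auto
  then obtain C where C: "\<And>x. x \<in> {-K..K} \<Longrightarrow> \<bar>f x\<bar> \<le> C"
    by (metis bounded_iff compact_imp_bounded image_eqI real_norm_def)
  \<comment> \<open>For negative \<open>K\<close> the interval is empty and \<open>C\<close> is
    arbitrary, possibly negative; the maximum with 0 covers the points where \<open>f\<close>
    vanishes.\<close>
  have "\<bar>f x\<bar> \<le> max C 0" for x
    using C[of x] K[of x] by (cases "\<bar>x\<bar> > K") (simp_all add: abs_le_iff max_def, linarith+)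
  with that show ?thesis by blast
qed

text \<open>Abstracts from the parameters in the products, so that facts about one
  \<open>T_r\<close> extend by induction. New factors enter on the right, as in the recursion of
  \<open>op_prod\<close>.\<close>

inductive euler_operator :: "operator \<Rightarrow> bool" where
  euler_operator_id: "euler_operator id"
| euler_operator_comp_T_op: "euler_operator A \<Longrightarrow> euler_operator (A \<circ> T_op r)"

lemma euler_operator_op_prod: "euler_operator (op_prod n (\<lambda>i. T_op (r i)))"
  by (induction n)
    (simp_all only: op_prod.simps euler_operator_id euler_operator_comp_T_op)

lemma euler_operator_C0_infinity:
  "euler_operator A \<Longrightarrow> f \<in> C0_infinity \<Longrightarrow> A f \<in> C0_infinity"
  by (induction arbitrary: f rule: euler_operator.induct) auto

lemma euler_operator_scale:
  "euler_operator A \<Longrightarrow> smooth f \<Longrightarrow> A (\<lambda>x. f (c * x)) = (\<lambda>x. A f (c * x))"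
  by (induction arbitrary: f rule: euler_operator.induct) (auto simp: T_op_scale smooth_T_op)

lemma euler_operator_T_op_commute:
  "euler_operator A \<Longrightarrow> smooth f \<Longrightarrow> A (T_op r f) = T_op r (A f)"
proof (induction arbitrary: f rule: euler_operator.induct)
  case (euler_operator_comp_T_op A s)
  then show ?case
    using T_op_commute[of f s r] by (simp add: smooth_T_op)
qed simp

lemma euler_operator_commute:
  "euler_operator A \<Longrightarrow> euler_operator B \<Longrightarrow> smooth f \<Longrightarrow> A (B f) = B (A f)"
proof (induction arbitrary: f rule: euler_operator.induct)
  case (euler_operator_comp_T_op A r)
  then show ?case
    using euler_operator_T_op_commute[of B f r] smooth_T_op[of f r] by (metis comp_apply)
qed simp

subsection \<open>The cutoff\<close>

definition cutoff :: "real \<Rightarrow> real" where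
  "cutoff z = z\<^sup>2 / (1 + z\<^sup>2)"

lemma cutoff_eq: "cutoff z = 1 + (-1) * inverse (1 + z\<^sup>2)"
  by (simp add: cutoff_def field_simps add_nonneg_eq_0_iff)

lemma one_plus_square_ne_0 [simp]: "1 + z\<^sup>2 \<noteq> (0::real)"
  by (metis add_nonneg_eq_0_iff zero_le_one zero_le_power2 zero_neq_one)

text \<open>The derivative is expressed through \<open>z\<close> and the function itself, which lets
  the induction for smoothness close up.\<close>

lemma DERIV_inverse_one_plus_square:
  "((\<lambda>z. inverse (1 + z\<^sup>2)) has_field_derivative
     (-2) * (z * (inverse (1 + z\<^sup>2) * inverse (1 + z\<^sup>2)))) (at z)" for z :: real
  by (auto intro!: derivative_eq_intros)

lemma smooth_inverse_one_plus_square: "smooth (\<lambda>z. inverse (1 + z\<^sup>2))"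
proof -
  have "differentiable_upto n (\<lambda>z. inverse (1 + z\<^sup>2))" for n
  proof (induction n)
    case 0
    then show ?case
      using DERIV_inverse_one_plus_square real_differentiable_def differentiable_upto_0 by blast
  next
    case (Suc n)
    have "deriv (\<lambda>z. inverse (1 + z\<^sup>2))
        = (\<lambda>z::real. (-2) * (z * (inverse (1 + z\<^sup>2) * inverse (1 + z\<^sup>2))))"
      by (intro ext DERIV_imp_deriv DERIV_inverse_one_plus_square)
    moreover have "\<forall>z::real. (\<lambda>z. inverse (1 + z\<^sup>2)) differentiable (at z)"
      using DERIV_inverse_one_plus_square real_differentiable_def by blast
    ultimately show ?case
      unfolding differentiable_upto_Suc
      using Suc
      by (auto simp only: intro!: differentiable_upto_mult differentiable_upto_const
          differentiable_upto_ident)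
  qed
  then show ?thesis by (simp add: smooth_iff_differentiable_upto)
qed

lemma smooth_cutoff: "smooth cutoff"
  unfolding cutoff_eq[abs_def] by (intro smooth_add smooth_mult smooth_const
    smooth_inverse_one_plus_square)

lemma smooth_poly_cutoff: "smooth (\<lambda>z. poly p (cutoff z))"
proof (induction p)
  case (pCons a p)
  then show ?case
    unfolding poly_pCons by (intro smooth_add smooth_mult smooth_const smooth_cutoff)
qed (simp add: smooth_const)

lemma cutoff_bounds: "0 \<le> cutoff z" "cutoff z \<le> 1" "cutoff z \<le> \<bar>z\<bar>"
proof -
  show "0 \<le> cutoff z" "cutoff z \<le> 1" by (auto simp: cutoff_def add_pos_nonneg)
  \<comment> \<open>Expands to 1 - |z| + z^2; multiplied by |z|, the resulting inequality is the
    third bound with its denominator cleared.\<close>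
  have "0 \<le> (\<bar>z\<bar> - 1)\<^sup>2 + \<bar>z\<bar>" by simp
  then have "\<bar>z\<bar> \<le> 1 + z\<^sup>2" by (simp add: power2_eq_square algebra_simps)
  then have "\<bar>z\<bar> * \<bar>z\<bar> \<le> \<bar>z\<bar> * (1 + z\<^sup>2)" by (intro mult_left_mono) auto
  then show "cutoff z \<le> \<bar>z\<bar>"
    by (simp add: cutoff_def divide_le_eq add_pos_nonneg power2_eq_square)
qed

text \<open>The Euler operator \<open>z d/dz\<close> acts on polynomials in the cutoff through
  \<open>p \<mapsto> 2u(1-u)p'(u)\<close>: the order of vanishing at \<open>u = 0\<close> is kept and the value at \<open>u = 1\<close> is killed.\<close>

definition euler_poly :: "real poly \<Rightarrow> real poly" where
  "euler_poly p = [:2, -2:] * ([:0, 1:] * pderiv p)"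

lemma deriv_poly_cutoff:
  "z * deriv (\<lambda>z. poly p (cutoff z)) z = poly (euler_poly p) (cutoff z)"
proof -
  have "(cutoff has_field_derivative 2 * z / (1 + z\<^sup>2)\<^sup>2) (at z)"
    unfolding cutoff_def
    by (auto intro!: derivative_eq_intros) (simp add: power2_eq_square algebra_simps)
  then have "((\<lambda>z. poly p (cutoff z)) has_field_derivative
      poly (pderiv p) (cutoff z) * (2 * z / (1 + z\<^sup>2)\<^sup>2)) (at z)"
    by (intro DERIV_chain2[OF poly_DERIV])
  then have "z * deriv (\<lambda>z. poly p (cutoff z)) z
      = poly (pderiv p) (cutoff z) * (2 * z\<^sup>2 / (1 + z\<^sup>2)\<^sup>2)"
    by (simp add: DERIV_imp_deriv power2_eq_square)
  also have "2 * z\<^sup>2 / (1 + z\<^sup>2)\<^sup>2 = 2 * cutoff z * (1 - cutoff z)"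
    by (simp add: cutoff_def divide_simps) (simp add: power2_eq_square algebra_simps)
  finally show ?thesis by (simp add: euler_poly_def algebra_simps)
qed

lemma poly_euler_poly_1 [simp]: "poly (euler_poly p) 1 = 0"
  by (simp add: euler_poly_def)

lemma dvd_euler_poly:
  assumes "[:0, 1:] ^ m dvd p"
  shows "[:0, 1:] ^ m dvd euler_poly p"
proof (cases m)
  case (Suc n)
  obtain s where s: "p = [:0, 1:] ^ m * s" using assms by (elim dvdE)
  \<comment> \<open>With u the indeterminate, the extra factor u restores the power lost in
    differentiation: u (u^m s)' = u^m (m s + u s').\<close>
  have "[:0, 1:] * pderiv p = [:0, 1:] ^ m * (smult (real m) s + [:0, 1:] * pderiv s)"
  proof -
    have "pderiv ([:0, 1:] ^ Suc n :: real poly) = smult (real (Suc n)) ([:0, 1:] ^ n)"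
      unfolding pderiv_power_Suc by (simp add: pderiv_pCons)
    then have "[:0, 1:] * pderiv p
        = [:0, 1:] * (smult (real (Suc n)) ([:0, 1:] ^ n) * s + [:0, 1:] ^ Suc n * pderiv s)"
      unfolding s Suc pderiv_mult by (simp only: algebra_simps)
    also have "\<dots> = [:0, 1:] ^ m * (smult (real m) s + [:0, 1:] * pderiv s)"
      unfolding Suc by (simp only: power_Suc mult_smult_left mult_smult_right ring_distribs mult.assoc
          mult.left_commute mult.commute)
    finally show ?thesis .
  qed
  then show ?thesis unfolding euler_poly_def by (metis dvd_mult dvd_triv_left)
qed simp

subsection \<open>Iterated Stein equations\<close>

lemma C0_infinity_borel_measurable: "f \<in> C0_infinity \<Longrightarrow> f \<in> borel_measurable borel"
  by (intro borel_measurable_continuous_onI smooth_continuous_on C0_infinity_smooth)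

lemma integrable_C0_infinity:
  assumes "prob_space P" "X \<in> borel_measurable P" "f \<in> C0_infinity"
  shows "integrable P (\<lambda>\<omega>. f (X \<omega>))"
proof -
  interpret prob_space P by fact
  obtain C where "\<And>x. \<bar>f x\<bar> \<le> C" using C0_infinity_bounded assms(3) by blast
  moreover note C0_infinity_borel_measurable[OF assms(3)]
  ultimately show ?thesis
    using assms(2) by (intro integrable_const_bound[of _ C]) auto
qed

lemma C0_infinity_power_mult:
  "f \<in> C0_infinity \<Longrightarrow> (\<lambda>x. x ^ n * f x) \<in> C0_infinity"
  by (intro C0_infinity_mult smooth_power smooth_ident)

text \<open>Each step trades one factor on the left for one on the right, since
  \<open>M^n T_{r+n} = T_r M^n\<close>.\<close>

lemma stein_equation_iterate:
  fixes \<mu> :: "real measure"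
  assumes stein: "\<And>g. g \<in> C0_infinity \<Longrightarrow>
      a * (\<integral>x. T_op r g x \<partial>\<mu>) = b * (\<integral>x. x ^ p * T_op s g x \<partial>\<mu>)"
    and r: "r \<noteq> -\<infinity>" and s: "s \<noteq> -\<infinity>" and f: "f \<in> C0_infinity"
  shows "a ^ k * (\<integral>x. op_prod k (\<lambda>i. T_op (r + ereal (real (i * p)))) f x \<partial>\<mu>)
    = b ^ k * (\<integral>x. x ^ (k * p) * op_prod k (\<lambda>i. T_op (s + ereal (real (i * p)))) f x \<partial>\<mu>)"
  using f
proof (induction k arbitrary: f)
  case (Suc k)
  let ?R = "op_prod k (\<lambda>i. T_op (r + ereal (real (i * p))))"
  let ?S = "op_prod k (\<lambda>i. T_op (s + ereal (real (i * p))))"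
  let ?r = "r + ereal (real (k * p))" and ?s = "s + ereal (real (k * p))"
  have S: "?S f \<in> C0_infinity"
    by (rule euler_operator_C0_infinity[OF euler_operator_op_prod Suc.prems])
  note smooth_S = C0_infinity_smooth[OF S]
  define u where "u = (\<lambda>x. x ^ (k * p) * ?S f x)"
  have u: "u \<in> C0_infinity"
    unfolding u_def by (intro C0_infinity_power_mult S)
  have comm: "?S (T_op t f) = T_op t (?S f)" for t
    by (rule euler_operator_T_op_commute[OF euler_operator_op_prod C0_infinity_smooth[OF Suc.prems]])
  have "a ^ Suc k * (\<integral>x. ?R (T_op ?r f) x \<partial>\<mu>) = a * (a ^ k * (\<integral>x. ?R (T_op ?r f) x \<partial>\<mu>))"
    by simp
  \<comment> \<open>The induction hypothesis is used for the test function \<open>T_op ?r f\<close>,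
    whose outermost operator is then pulled out in front of \<open>?S\<close>.\<close>
  also have "\<dots> = a * (b ^ k * (\<integral>x. x ^ (k * p) * T_op ?r (?S f) x \<partial>\<mu>))"
    using Suc.IH[OF C0_infinity_T_op[OF Suc.prems]] by (simp only: comm)
  \<comment> \<open>The weight absorbs the shift \<open>k * p\<close>, exposing a bare
    \<open>T_op r\<close> to which the original equation applies.\<close>
  also have "(\<lambda>x. x ^ (k * p) * T_op ?r (?S f) x) = T_op r u"
    unfolding u_def using T_op_power_mult[OF smooth_S r] by simp
  also have "a * (b ^ k * (\<integral>x. T_op r u x \<partial>\<mu>)) = b ^ k * (a * (\<integral>x. T_op r u x \<partial>\<mu>))"
    by simp
  also have "\<dots> = b ^ Suc k * (\<integral>x. x ^ p * T_op s u x \<partial>\<mu>)"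
    unfolding stein[OF u] by simp
  \<comment> \<open>Passing back through the weight restores the shift, which yields the factor with
    index \<open>k\<close> of the longer product.\<close>
  also have "T_op s u = (\<lambda>x. x ^ (k * p) * ?S (T_op ?s f) x)"
    unfolding u_def comm using T_op_power_mult[OF smooth_S s] by simp
  also have "(\<lambda>x. x ^ p * (x ^ (k * p) * ?S (T_op ?s f) x))
      = (\<lambda>x. x ^ (Suc k * p) * ?S (T_op ?s f) x)"
    by (simp add: power_add mult.assoc)
  finally show ?case
    by (simp only: op_prod.simps comp_apply)
qed simp

subsection \<open>Test functions of two variables\<close>

text \<open>In \<open>mixed_test m \<Phi> G\<close>, the function \<open>G\<close> is the limit: \<open>\<Phi> (\<epsilon>x) (y/\<epsilon>) \<rightarrow> G (xy)\<close> as
  \<open>\<epsilon> \<rightarrow> 0\<close>, for \<open>y \<noteq> 0\<close>.\<close>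

inductive mixed_test :: "nat \<Rightarrow> (real \<Rightarrow> real \<Rightarrow> real) \<Rightarrow> (real \<Rightarrow> real) \<Rightarrow> bool" for m where
  mixed_test_base: "G \<in> C0_infinity \<Longrightarrow> [:0, 1:] ^ m dvd p \<Longrightarrow>
     mixed_test m (\<lambda>x z. G (x * z) * poly p (cutoff z)) (\<lambda>x. poly p 1 * G x)"
| mixed_test_add: "mixed_test m \<Phi> G \<Longrightarrow> mixed_test m \<Psi> H \<Longrightarrow>
     mixed_test m (\<lambda>x z. \<Phi> x z + \<Psi> x z) (\<lambda>x. G x + H x)"

lemma mixed_test_limit_C0_infinity: "mixed_test m \<Phi> G \<Longrightarrow> G \<in> C0_infinity"
  by (induction rule: mixed_test.induct) auto

lemma mixed_test_smooth:
  assumes "mixed_test m \<Phi> G"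
  shows "smooth (\<lambda>x. \<Phi> x z)" "smooth (\<Phi> x)"
  using assms
proof (induction rule: mixed_test.induct)
  case (mixed_test_base G p)
  have G: "smooth (\<lambda>x. G (t * x))" for t
    using mixed_test_base by (intro smooth_scale C0_infinity_smooth)
  {
    case 1
    show ?case
      using smooth_mult[OF G[of z] smooth_const[of "poly p (cutoff z)"]] by (simp add: mult.commute)
  next
    case 2
    show ?case by (intro smooth_mult[OF G smooth_poly_cutoff])
  }
qed (auto intro: smooth_add)

lemma mixed_test_C0_infinity_fst:
  assumes "mixed_test m \<Phi> G" "z \<noteq> 0"
  shows "(\<lambda>x. \<Phi> x z) \<in> C0_infinity"
  using assms
proof (induction rule: mixed_test.induct)
  case (mixed_test_base G p)
  then show ?case
    using C0_infinity_mult(1)[OF C0_infinity_scale[of G z] smooth_const[of "poly p (cutoff z)"]]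
    by (simp add: mult.commute)
qed auto

text \<open>The cutoff factor tends to \<open>poly p 1\<close> at infinity, so compact support comes
  from \<open>G\<close> alone; at \<open>x = 0\<close> that factor is the constant
  \<open>G 0\<close>.\<close>

lemma mixed_test_C0_infinity_snd:
  assumes "mixed_test m \<Phi> G" "x \<noteq> 0"
  shows "\<Phi> x \<in> C0_infinity"
  using assms
proof (induction rule: mixed_test.induct)
  case (mixed_test_base G p)
  then show ?case
    by (intro C0_infinity_mult(1) C0_infinity_scale smooth_poly_cutoff)
qed auto

lemma T_op_scale_mult_const:
  assumes "smooth G"
  shows "T_op r (\<lambda>x. G (x * z) * c) = (\<lambda>x. T_op r G (x * z) * c)"
  using T_op_cmult[OF smooth_scale[OF assms], of r c z] T_op_scale[OF assms, of r z]
  by (simp add: mult.commute)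

text \<open>Leibniz rule combined with invariance under dilation. One product becomes a sum of two
  of the same shape, which is why \<open>mixed_test\<close> is closed under sums.\<close>

lemma T_op_scale_mult_cutoff:
  assumes "smooth G" "r \<noteq> \<infinity>"
  shows "T_op r (\<lambda>z. G (x * z) * poly p (cutoff z))
    = (\<lambda>z. T_op r G (x * z) * poly p (cutoff z) + G (x * z) * poly (euler_poly p) (cutoff z))"
  by (simp add: T_op_mult[OF smooth_scale[OF assms(1)] smooth_poly_cutoff assms(2)]
      T_op_scale[OF assms(1)] deriv_poly_cutoff)

lemma mixed_test_T_op_fst:
  assumes "mixed_test m \<Phi> G"
  shows "mixed_test m (\<lambda>x z. T_op r (\<lambda>x. \<Phi> x z) x) (T_op r G)"
  using assms
proof (induction rule: mixed_test.induct)
  case (mixed_test_base G p)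
  then show ?case
    using mixed_test.mixed_test_base[OF C0_infinity_T_op[of G r] mixed_test_base(2)]
    by (simp add: T_op_scale_mult_const T_op_cmult C0_infinity_smooth)
next
  case (mixed_test_add \<Phi> G \<Psi> H)
  show ?case
    using mixed_test.mixed_test_add[OF mixed_test_add.IH] mixed_test_add.hyps
    by (simp add: T_op_add mixed_test_smooth C0_infinity_smooth mixed_test_limit_C0_infinity)
qed

text \<open>The term in which the cutoff is differentiated has limit 0, since
  \<open>euler_poly p\<close> vanishes at 1, and it keeps the divisibility by u^m. The limit thus
  sees \<open>T_op r G\<close> only.\<close>

lemma mixed_test_T_op_snd:
  assumes "mixed_test m \<Phi> G"
  shows "mixed_test m (\<lambda>x z. T_op r (\<Phi> x) z) (T_op r G)"
  using assms
proof (induction rule: mixed_test.induct)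
  case (mixed_test_base G p)
  show ?case
  proof (cases "r = \<infinity>")
    case True
    with mixed_test_base show ?thesis by (simp add: mixed_test.mixed_test_base)
  next
    case False
    have "mixed_test m (\<lambda>x z. G (x * z) * poly (euler_poly p) (cutoff z)) (\<lambda>x. 0)"
      using mixed_test.mixed_test_base[OF mixed_test_base(1) dvd_euler_poly[OF mixed_test_base(2)]]
      by simp
    from mixed_test.mixed_test_add[OF mixed_test.mixed_test_base[OF C0_infinity_T_op[of G r]
          mixed_test_base(2)] this] False mixed_test_base
    show ?thesis
      by (simp add: T_op_scale_mult_cutoff T_op_cmult C0_infinity_smooth)
  qed
next
  case (mixed_test_add \<Phi> G \<Psi> H)
  show ?case
    using mixed_test.mixed_test_add[OF mixed_test_add.IH] mixed_test_add.hyps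
    by (simp add: T_op_add mixed_test_smooth C0_infinity_smooth mixed_test_limit_C0_infinity)
qed

text \<open>On a base term with finite \<open>s\<close>, both orders add
  \<open>T_op r G (x * z)\<close> times the \<open>euler_poly p\<close> factor to the mixed term,
  where commutation on the line applies.\<close>

lemma mixed_test_T_op_commute:
  assumes "mixed_test m \<Phi> G"
  shows "T_op r (\<lambda>x. T_op s (\<Phi> x) z) x = T_op s (\<lambda>z. T_op r (\<lambda>x. \<Phi> x z) x) z"
  using assms
proof (induction arbitrary: x z rule: mixed_test.induct)
  case (mixed_test_base G p)
  then have G: "smooth G" by (simp add: C0_infinity_smooth)
  note TG = smooth_T_op[OF G]
  show ?case
  proof (cases "s = \<infinity>")
    case False
    have sm: "smooth (\<lambda>x. H (x * z) * c)" if "smooth H" for H c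
      using smooth_mult[OF smooth_scale[OF that, of z] smooth_const[of c]] by (simp add: mult.commute)
    show ?thesis
      by (simp add: False T_op_scale_mult_const G TG T_op_scale_mult_cutoff T_op_add sm T_op_commute[OF G, of r s])
  qed simp
next
  case (mixed_test_add \<Phi> G \<Psi> H)
  note sm = mixed_test_smooth[OF mixed_test_add.hyps(1)] mixed_test_smooth[OF mixed_test_add.hyps(2)]
    mixed_test_smooth[OF mixed_test_T_op_fst[OF mixed_test_add.hyps(1)]]
    mixed_test_smooth[OF mixed_test_T_op_fst[OF mixed_test_add.hyps(2)]]
    mixed_test_smooth[OF mixed_test_T_op_snd[OF mixed_test_add.hyps(1)]]
    mixed_test_smooth[OF mixed_test_T_op_snd[OF mixed_test_add.hyps(2)]]
  show ?case
    by (simp add: T_op_add sm mixed_test_add.IH)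
qed

lemma mixed_test_euler_operator_fst:
  assumes "euler_operator A" "mixed_test m \<Phi> G"
  shows "mixed_test m (\<lambda>x z. A (\<lambda>x. \<Phi> x z) x) (A G)"
  using assms
proof (induction arbitrary: \<Phi> G rule: euler_operator.induct)
  case (euler_operator_comp_T_op A r)
  from euler_operator_comp_T_op.IH[OF mixed_test_T_op_fst[OF euler_operator_comp_T_op.prems]]
  show ?case by simp
qed simp

lemma mixed_test_euler_operator_snd:
  assumes "euler_operator A" "mixed_test m \<Phi> G"
  shows "mixed_test m (\<lambda>x z. A (\<Phi> x) z) (A G)"
  using assms
proof (induction arbitrary: \<Phi> G rule: euler_operator.induct)
  case (euler_operator_comp_T_op A r)
  from euler_operator_comp_T_op.IH[OF mixed_test_T_op_snd[OF euler_operator_comp_T_op.prems]]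
  show ?case by simp
qed simp

lemma mixed_test_euler_operator_T_op_commute:
  assumes "euler_operator A" "mixed_test m \<Phi> G"
  shows "A (\<lambda>x. T_op s (\<Phi> x) z) x = T_op s (\<lambda>z. A (\<lambda>x. \<Phi> x z) x) z"
  using assms
proof (induction arbitrary: \<Phi> G x z rule: euler_operator.induct)
  case (euler_operator_comp_T_op A r)
  note euler_operator_comp_T_op.IH[OF mixed_test_T_op_fst[OF euler_operator_comp_T_op.prems]]
  moreover have "T_op r (\<lambda>x. T_op s (\<Phi> x) z) = (\<lambda>x. T_op s (\<lambda>z. T_op r (\<lambda>x. \<Phi> x z) x) z)"
    by (rule ext) (rule mixed_test_T_op_commute[OF euler_operator_comp_T_op.prems])
  ultimately show ?case by simp
qed simp

text \<open>Allows the intermediate term to be read in two ways: with the operator in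
  \<open>x\<close> applied last, as the first Stein equation needs, or the one in \<open>z\<close>,
  as the second does.\<close>

lemma mixed_test_euler_operator_commute:
  assumes "euler_operator B" "euler_operator A" "mixed_test m \<Phi> G"
  shows "A (\<lambda>x. B (\<Phi> x) z) x = B (\<lambda>z. A (\<lambda>x. \<Phi> x z) x) z"
  using assms
proof (induction arbitrary: \<Phi> G x z rule: euler_operator.induct)
  case (euler_operator_comp_T_op B s)
  note euler_operator_comp_T_op.IH[OF euler_operator_comp_T_op.prems(1)
      mixed_test_T_op_snd[OF euler_operator_comp_T_op.prems(2)]]
  moreover have "(\<lambda>z. A (\<lambda>x. T_op s (\<Phi> x) z) x) = T_op s (\<lambda>z. A (\<lambda>x. \<Phi> x z) x)"
    by (rule ext) (rule mixed_test_euler_operator_T_op_commute[OF euler_operator_comp_T_op.prems])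
  ultimately show ?case by simp
qed simp

section \<open>Bounds and limits of the two-variable test functions\<close>

lemma mixed_test_continuous:
  assumes "mixed_test m \<Phi> G"
  shows "continuous_on UNIV (\<lambda>w. \<Phi> (fst w) (snd w))"
  using assms
proof (induction rule: mixed_test.induct)
  case (mixed_test_base G p)
  have "continuous_on UNIV (\<lambda>w::real \<times> real. G (fst w * snd w))"
    using mixed_test_base
    by (intro continuous_on_compose2[OF smooth_continuous_on[of G UNIV]] C0_infinity_smooth
        continuous_intros) auto
  moreover have "continuous_on UNIV (\<lambda>w::real \<times> real. poly p (cutoff (snd w)))"
    by (intro continuous_on_compose2[OF smooth_continuous_on[OF smooth_poly_cutoff, of UNIV]]
        continuous_intros) auto
  ultimately show ?case by (intro continuous_on_mult)
qed (intro continuous_on_add)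

text \<open>The three bounds serve the initial, intermediate and final integrands of the product
  argument. Writing p = u^m s, the factor \<open>s\<close> is bounded on [0,1], where the cutoff
  takes its values, and compact support of \<open>G\<close> controls powers of
  \<open>x * z\<close>.\<close>

lemma mixed_test_bounded:
  assumes "mixed_test m \<Phi> G"
  shows "\<exists>C. \<forall>x z. \<bar>\<Phi> x z\<bar> \<le> C \<and> \<bar>x ^ m * \<Phi> x z\<bar> \<le> C \<and> \<bar>(x * z) ^ m * \<Phi> x z\<bar> \<le> C"
  using assms
proof (induction rule: mixed_test.induct)
  case (mixed_test_base G p)
  obtain s where s: "p = [:0, 1:] ^ m * s" using mixed_test_base by (elim dvdE)
  obtain C where C: "\<And>x. \<bar>G x\<bar> \<le> C" using C0_infinity_bounded mixed_test_base by blast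
  obtain D where D: "\<And>x. \<bar>x ^ m * G x\<bar> \<le> D"
    using C0_infinity_bounded C0_infinity_power_mult mixed_test_base by blast
  have "compact (poly s ` {0..1})" by (intro compact_continuous_image continuous_intros) auto
  then obtain E where E: "\<And>u. u \<in> {0..1} \<Longrightarrow> \<bar>poly s u\<bar> \<le> E"
    by (metis bounded_iff compact_imp_bounded image_eqI real_norm_def)
  have s_bound: "\<bar>poly s (cutoff z)\<bar> \<le> E" for z
    using cutoff_bounds by (intro E) auto
  have E0: "E \<ge> 0" using s_bound[of 0] by linarith
  have C0: "C \<ge> 0" using C[of 0] by linarith
  have D0: "D \<ge> 0" using D[of 0] by linarith
  have p_eq: "poly p (cutoff z) = cutoff z ^ m * poly s (cutoff z)" for z
    by (simp add: s)
  have p_bound: "\<bar>poly p (cutoff z)\<bar> \<le> E" for z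
  proof -
    have "\<bar>cutoff z ^ m\<bar> \<le> 1" using cutoff_bounds by (simp add: power_le_one)
    then have "\<bar>cutoff z ^ m\<bar> * \<bar>poly s (cutoff z)\<bar> \<le> 1 * E"
      using s_bound by (intro mult_mono) auto
    then show ?thesis by (simp add: p_eq abs_mult)
  qed
  have "\<bar>G (x * z) * poly p (cutoff z)\<bar> \<le> C * E" for x z
    unfolding abs_mult using C p_bound C0 by (intro mult_mono) auto
  moreover have "\<bar>(x * z) ^ m * (G (x * z) * poly p (cutoff z))\<bar> \<le> D * E" for x z
  proof -
    have "\<bar>(x * z) ^ m * G (x * z)\<bar> * \<bar>poly p (cutoff z)\<bar> \<le> D * E"
      using D p_bound D0 by (intro mult_mono) auto
    then show ?thesis by (simp add: abs_mult mult.assoc)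
  qed
  moreover have "\<bar>x ^ m * (G (x * z) * poly p (cutoff z))\<bar> \<le> D * E" for x z
  proof -
    \<comment> \<open>Divisibility by u^m pays off here: since u(z) \<le> |z|, the cutoff supplies
      the missing power of \<open>z\<close>.\<close>
    have "\<bar>x\<bar> ^ m * \<bar>cutoff z\<bar> ^ m \<le> \<bar>x\<bar> ^ m * \<bar>z\<bar> ^ m"
      using cutoff_bounds by (intro mult_left_mono power_mono) auto
    then have "(\<bar>x\<bar> ^ m * \<bar>cutoff z\<bar> ^ m) * \<bar>G (x * z)\<bar> * \<bar>poly s (cutoff z)\<bar>
        \<le> (\<bar>x\<bar> ^ m * \<bar>z\<bar> ^ m) * \<bar>G (x * z)\<bar> * \<bar>poly s (cutoff z)\<bar>"
      by (intro mult_right_mono) auto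
    also have "\<dots> = \<bar>(x * z) ^ m * G (x * z)\<bar> * \<bar>poly s (cutoff z)\<bar>"
      by (simp add: abs_mult power_mult_distrib power_abs)
    also have "\<dots> \<le> D * E" using D s_bound D0 by (intro mult_mono) auto
    finally show ?thesis by (simp add: p_eq abs_mult power_abs mult_ac)
  qed
  ultimately show ?case by (intro exI[of _ "max (C * E) (D * E)"]) (auto simp: le_max_iff_disj)
next
  case (mixed_test_add \<Phi> G \<Psi> H)
  then obtain C D where
    C: "\<And>x z. \<bar>\<Phi> x z\<bar> \<le> C \<and> \<bar>x ^ m * \<Phi> x z\<bar> \<le> C \<and> \<bar>(x * z) ^ m * \<Phi> x z\<bar> \<le> C" and
    D: "\<And>x z. \<bar>\<Psi> x z\<bar> \<le> D \<and> \<bar>x ^ m * \<Psi> x z\<bar> \<le> D \<and> \<bar>(x * z) ^ m * \<Psi> x z\<bar> \<le> D"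
    by blast
  have "\<bar>t * (u + v)\<bar> \<le> C + D" if "\<bar>t * u\<bar> \<le> C" "\<bar>t * v\<bar> \<le> D" for t u v :: real
    using that by (simp add: distrib_left)
  moreover have "\<bar>u + v\<bar> \<le> C + D" if "\<bar>u\<bar> \<le> C" "\<bar>v\<bar> \<le> D" for u v :: real
    using that by simp
  ultimately show ?case using C D by (intro exI[of _ "C + D"]) blast
qed

lemma cutoff_tendsto_1:
  assumes "y \<noteq> 0"
  shows "(\<lambda>n. cutoff (y * real (Suc n))) \<longlonglongrightarrow> 1"
proof -
  have "filterlim (\<lambda>n. real (Suc n)) at_top sequentially"
    by (rule filterlim_compose[OF filterlim_real_sequentially filterlim_Suc])
  then have "filterlim (\<lambda>n. y\<^sup>2 * (real (Suc n))\<^sup>2) at_top sequentially"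
    using assms by (intro filterlim_tendsto_pos_mult_at_top[OF tendsto_const] filterlim_pow_at_top)
      (auto simp: zero_less_power2)
  then have "filterlim (\<lambda>n. 1 + y\<^sup>2 * (real (Suc n))\<^sup>2) at_top sequentially"
    by (intro filterlim_tendsto_add_at_top[OF tendsto_const])
  then have "(\<lambda>n. inverse (1 + y\<^sup>2 * (real (Suc n))\<^sup>2)) \<longlonglongrightarrow> 0"
    by (rule tendsto_inverse_0_at_top)
  then have "(\<lambda>n. 1 + (-1) * inverse (1 + y\<^sup>2 * (real (Suc n))\<^sup>2)) \<longlonglongrightarrow> 1 + (-1) * 0"
    by (intro tendsto_intros)
  then show ?thesis by (simp only: cutoff_eq power_mult_distrib) simp
qed

lemma mixed_test_tendsto:
  assumes "mixed_test m \<Phi> G" "y \<noteq> 0"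
  shows "(\<lambda>n. \<Phi> (x / real (Suc n)) (y * real (Suc n))) \<longlonglongrightarrow> G (x * y)"
  using assms
proof (induction rule: mixed_test.induct)
  case (mixed_test_base G p)
  \<comment> \<open>With \<epsilon> = 1/(n+1) the two dilations cancel in the argument of
    \<open>G\<close>; only the cutoff depends on \<open>n\<close>.\<close>
  have "x / real (Suc n) * (y * real (Suc n)) = x * y" for n by simp
  moreover have "(\<lambda>n. G (x * y) * poly p (cutoff (y * real (Suc n)))) \<longlonglongrightarrow> G (x * y) * poly p 1"
    using mixed_test_base by (intro tendsto_intros cutoff_tendsto_1)
  ultimately show ?case by (simp only: mult.commute[of "poly p 1"])
qed (auto intro: tendsto_add)

subsection \<open>The product\<close>

text \<open>Products of the \<open>T_r\<close> commute with dilations, so a dilated test function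
  dilates both integrands while the weight \<open>x ^ m\<close> stays as it is.\<close>

lemma stein_equation_scale:
  fixes \<mu> :: "real measure"
  assumes "\<And>g. g \<in> C0_infinity \<Longrightarrow>
      c * (\<integral>x. A g x \<partial>\<mu>) = d * (\<integral>x. x ^ m * B g x \<partial>\<mu>)"
    and "euler_operator A" "euler_operator B" "g \<in> C0_infinity" "t \<noteq> 0"
  shows "c * (\<integral>x. A g (t * x) \<partial>\<mu>) = d * (\<integral>x. x ^ m * B g (t * x) \<partial>\<mu>)"
  using assms(1)[OF C0_infinity_scale[OF assms(4,5)]]
    euler_operator_scale[OF assms(2) C0_infinity_smooth[OF assms(4)], of t]
    euler_operator_scale[OF assms(3) C0_infinity_smooth[OF assms(4)], of t]
  by simp

lemma product_stein_equation:
  fixes \<mu> \<nu> :: "real measure"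
  assumes prob: "prob_space \<mu>" "prob_space \<nu>"
    and sets: "sets \<mu> = sets borel" "sets \<nu> = sets borel"
    and nz: "AE x in \<mu>. x \<noteq> 0" "AE y in \<nu>. y \<noteq> 0"
    and euler: "euler_operator A" "euler_operator B" "euler_operator C" "euler_operator D"
    and stein_fst: "\<And>g. g \<in> C0_infinity \<Longrightarrow>
      a * (\<integral>x. A g x \<partial>\<mu>) = b * (\<integral>x. x ^ m * B g x \<partial>\<mu>)"
    and stein_snd: "\<And>g. g \<in> C0_infinity \<Longrightarrow>
      c * (\<integral>y. C g y \<partial>\<nu>) = d * (\<integral>y. y ^ m * D g y \<partial>\<nu>)"
    and f: "f \<in> C0_infinity"
  shows "a * c * (\<integral>w. A (C f) (fst w * snd w) \<partial>(\<mu> \<Otimes>\<^sub>M \<nu>))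
    = b * d * (\<integral>w. (fst w * snd w) ^ m * B (D f) (fst w * snd w) \<partial>(\<mu> \<Otimes>\<^sub>M \<nu>))"
proof -
  interpret \<mu>: prob_space \<mu> by fact
  interpret \<nu>: prob_space \<nu> by fact
  interpret pair: pair_prob_space \<mu> \<nu> ..
  note [measurable_cong] = sets
  have sets_pair: "sets (\<mu> \<Otimes>\<^sub>M \<nu>) = sets (borel :: (real \<times> real) measure)"
    using sets_pair_measure_cong[OF sets] unfolding borel_prod .

  \<comment> \<open>Evaluated at \<open>x / s\<close> and \<open>y * s\<close> with s =
    1/\<epsilon>, this is the regularised test function f(xy) u(ys)^m.\<close>
  define \<Phi> where "\<Phi> = (\<lambda>x z. f (x * z) * poly ([:0, 1:] ^ m) (cutoff z))"
  have \<Phi>: "mixed_test m \<Phi> f"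
    using mixed_test_base[OF f dvd_refl, of m] by (simp add: \<Phi>_def)
  \<comment> \<open>Three stages: the equation in \<open>x\<close> trades \<open>A\<close> for
    \<open>B\<close> and leads from \<open>F\<close> to \<open>G\<close>; the one in
    \<open>y\<close> trades \<open>C\<close> for \<open>D\<close> and leads from \<open>G\<close> to
    \<open>H\<close>.\<close>
  define F where "F = (\<lambda>x z. A (\<lambda>x. C (\<Phi> x) z) x)"
  define G where "G = (\<lambda>x z. B (\<lambda>x. C (\<Phi> x) z) x)"
  define H where "H = (\<lambda>x z. D (\<lambda>z. B (\<lambda>x. \<Phi> x z) x) z)"
  note C\<Phi> = mixed_test_euler_operator_snd[OF euler(3) \<Phi>]
  note B\<Phi> = mixed_test_euler_operator_fst[OF euler(2) \<Phi>]
  have F: "mixed_test m F (A (C f))"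
    unfolding F_def by (rule mixed_test_euler_operator_fst[OF euler(1) C\<Phi>])
  have G: "mixed_test m G (B (C f))"
    unfolding G_def by (rule mixed_test_euler_operator_fst[OF euler(2) C\<Phi>])
  have H: "mixed_test m H (B (D f))"
    unfolding H_def euler_operator_commute[OF euler(2,4) C0_infinity_smooth[OF f]]
    by (rule mixed_test_euler_operator_snd[OF euler(4) B\<Phi>])
  have G_eq: "G x = C (\<lambda>z. B (\<lambda>x. \<Phi> x z) x)" for x
    unfolding G_def by (rule ext) (rule mixed_test_euler_operator_commute[OF euler(3,2) \<Phi>])

  have meas: "(\<lambda>w. K (fst w / s) (snd w * s)) \<in> borel_measurable (\<mu> \<Otimes>\<^sub>M \<nu>)"
    if "mixed_test m K L" for K L s
  proof -
    have "continuous_on UNIV (\<lambda>w::real \<times> real. K (fst w * inverse s) (snd w * s))"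
    proof -
      have "continuous_on UNIV (\<lambda>w::real \<times> real. (fst w * inverse s, snd w * s))"
        by (intro continuous_intros)
      from continuous_on_compose2[OF mixed_test_continuous[OF that] this] show ?thesis by simp
    qed
    then show ?thesis
      unfolding measurable_cong_sets[OF sets_pair refl] divide_inverse
      by (rule borel_measurable_continuous_onI)
  qed

  have step: "a * c * (\<integral>w. F (fst w / s) (snd w * s) \<partial>(\<mu> \<Otimes>\<^sub>M \<nu>))
      = b * d * (\<integral>w. (fst w * snd w) ^ m * H (fst w / s) (snd w * s) \<partial>(\<mu> \<Otimes>\<^sub>M \<nu>))"
    if s: "s > 0" for s :: real
  proof -
    have "a * (\<integral>x. F (x / s) (y * s) \<partial>\<mu>) = b * (\<integral>x. x ^ m * G (x / s) (y * s) \<partial>\<mu>)"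
      if "y \<noteq> 0" for y
    proof -
      \<comment> \<open>Here \<open>y * s\<close> is a frozen parameter, nonzero so that the section
        in \<open>x\<close> has compact support; \<open>1 / s\<close> is the dilation.\<close>
      have "y * s \<noteq> 0" "1 / s \<noteq> 0" using s that by auto
      from stein_equation_scale[where A = A and B = B and \<mu> = \<mu>, OF stein_fst euler(1,2)
          mixed_test_C0_infinity_fst[OF C\<Phi> this(1)] this(2)]
      show ?thesis unfolding F_def G_def by simp
    qed
    then have fst_eq: "AE y in \<nu>. a * (\<integral>x. F (x / s) (y * s) \<partial>\<mu>)
        = b * (\<integral>x. x ^ m * G (x / s) (y * s) \<partial>\<mu>)"
      using nz(2) by auto
    have "c * (\<integral>y. G (x / s) (y * s) \<partial>\<nu>) = d * (\<integral>y. y ^ m * H (x / s) (y * s) \<partial>\<nu>)"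
      if "x \<noteq> 0" for x
    proof -
      have "x / s \<noteq> 0" "s \<noteq> 0" using s that by auto
      from stein_equation_scale[where A = C and B = D and \<mu> = \<nu>, OF stein_snd euler(3,4)
          mixed_test_C0_infinity_snd[OF B\<Phi> this(1)] this(2)]
      show ?thesis unfolding G_eq H_def mult.commute[of s] .
    qed
    then have snd_eq: "AE x in \<mu>. c * (\<integral>y. G (x / s) (y * s) \<partial>\<nu>)
        = d * (\<integral>y. y ^ m * H (x / s) (y * s) \<partial>\<nu>)"
      using nz(1) by auto

    obtain K where K: "\<And>x z. \<bar>F x z\<bar> \<le> K" using mixed_test_bounded[OF F] by blast
    have F_int: "integrable (\<mu> \<Otimes>\<^sub>M \<nu>) (\<lambda>(x, y). F (x / s) (y * s))"
      unfolding case_prod_beta using K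
      by (intro pair.integrable_const_bound[of _ K] meas[OF F]) auto
    obtain L where L: "\<And>x z. \<bar>x ^ m * G x z\<bar> \<le> L" using mixed_test_bounded[OF G] by blast
    \<comment> \<open>This bound grows with \<open>s\<close>, which is harmless: \<open>G\<close>
      occurs at a fixed scale and is eliminated before the limit.\<close>
    have "\<bar>x ^ m * G (x / s) (y * s)\<bar> \<le> s ^ m * L" for x y
    proof -
      have "\<bar>x ^ m * G (x / s) (y * s)\<bar> = s ^ m * \<bar>(x / s) ^ m * G (x / s) (y * s)\<bar>"
        using s by (simp add: abs_mult power_divide power_abs)
      also have "\<dots> \<le> s ^ m * L" using s L by (intro mult_left_mono) auto
      finally show ?thesis .
    qed
    then have G_int: "integrable (\<mu> \<Otimes>\<^sub>M \<nu>) (\<lambda>(x, y). x ^ m * G (x / s) (y * s))"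
      unfolding case_prod_beta
      by (intro pair.integrable_const_bound[of _ "s ^ m * L"] borel_measurable_times meas[OF G]) auto
    obtain M where M: "\<And>x z. \<bar>(x * z) ^ m * H x z\<bar> \<le> M" using mixed_test_bounded[OF H] by blast
    \<comment> \<open>Since \<open>(x / s) * (y * s) = x * y\<close>, this bound is independent of
      \<open>s\<close>.\<close>
    have "\<bar>(x * y) ^ m * H (x / s) (y * s)\<bar> \<le> M" for x y
      using M[of "x / s" "y * s"] s by simp
    then have H_int: "integrable (\<mu> \<Otimes>\<^sub>M \<nu>) (\<lambda>(x, y). (x * y) ^ m * H (x / s) (y * s))"
      unfolding case_prod_beta
      by (intro pair.integrable_const_bound[of _ M] borel_measurable_times meas[OF H]) auto

    \<comment> \<open>Fubini with \<open>y\<close> outside serves the equation in \<open>x\<close>;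
      the order is then reversed for the equation in \<open>y\<close>. Integrability on the product
      also makes the inner integrals measurable.\<close>
    have "a * c * (\<integral>(x, y). F (x / s) (y * s) \<partial>(\<mu> \<Otimes>\<^sub>M \<nu>))
        = c * (\<integral>y. a * (\<integral>x. F (x / s) (y * s) \<partial>\<mu>) \<partial>\<nu>)"
      using pair.integral_snd[OF F_int] by simp
    also have "(\<integral>y. a * (\<integral>x. F (x / s) (y * s) \<partial>\<mu>) \<partial>\<nu>)
        = (\<integral>y. b * (\<integral>x. x ^ m * G (x / s) (y * s) \<partial>\<mu>) \<partial>\<nu>)"
      using pair.integrable_snd[OF F_int] pair.integrable_snd[OF G_int] fst_eq
      by (intro integral_cong_AE) (auto intro!: borel_measurable_integrable)
    also have "c * \<dots> = c * b * (\<integral>(x, y). x ^ m * G (x / s) (y * s) \<partial>(\<mu> \<Otimes>\<^sub>M \<nu>))"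
      using pair.integral_snd[OF G_int] by simp
    also have "\<dots> = b * (\<integral>x. c * (\<integral>y. x ^ m * G (x / s) (y * s) \<partial>\<nu>) \<partial>\<mu>)"
      using pair.integral_fst[OF G_int] by simp
    also have "(\<integral>x. c * (\<integral>y. x ^ m * G (x / s) (y * s) \<partial>\<nu>) \<partial>\<mu>)
        = (\<integral>x. d * (\<integral>y. (x * y) ^ m * H (x / s) (y * s) \<partial>\<nu>) \<partial>\<mu>)"
    proof (rule integral_cong_AE)
      show "AE x in \<mu>. c * (\<integral>y. x ^ m * G (x / s) (y * s) \<partial>\<nu>)
          = d * (\<integral>y. (x * y) ^ m * H (x / s) (y * s) \<partial>\<nu>)"
        using snd_eq
      proof eventually_elim
        case (elim x)
        have "c * (\<integral>y. x ^ m * G (x / s) (y * s) \<partial>\<nu>)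
            = x ^ m * (c * (\<integral>y. G (x / s) (y * s) \<partial>\<nu>))"
          by simp
        also have "\<dots> = d * (\<integral>y. x ^ m * (y ^ m * H (x / s) (y * s)) \<partial>\<nu>)"
          unfolding elim by simp
        finally show ?case by (simp only: power_mult_distrib mult.assoc)
      qed
    qed (use pair.integrable_fst[OF G_int] pair.integrable_fst[OF H_int] in
        \<open>auto intro!: borel_measurable_times borel_measurable_integrable\<close>)
    also have "b * \<dots> = b * d * (\<integral>(x, y). (x * y) ^ m * H (x / s) (y * s) \<partial>(\<mu> \<Otimes>\<^sub>M \<nu>))"
      using pair.integral_fst[OF H_int] by simp
    finally show ?thesis unfolding case_prod_beta .
  qed

  \<comment> \<open>The cutoff tends to 1 off \<open>y = 0\<close>, and that line is null for the
    product measure.\<close>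
  have nz_pair: "AE w in \<mu> \<Otimes>\<^sub>M \<nu>. snd w \<noteq> 0"
  proof (rule pair.AE_pair_measure)
    show "{w \<in> space (\<mu> \<Otimes>\<^sub>M \<nu>). snd w \<noteq> 0} \<in> sets (\<mu> \<Otimes>\<^sub>M \<nu>)" by measurable
    show "AE x in \<mu>. AE y in \<nu>. snd (x, y) \<noteq> 0" using nz(2) by simp
  qed
  have cont: "(\<lambda>w. K (fst w * snd w)) \<in> borel_measurable (\<mu> \<Otimes>\<^sub>M \<nu>)" if "K \<in> C0_infinity" for K
    using C0_infinity_borel_measurable[OF that] by measurable

  obtain K where K: "\<And>x z. \<bar>F x z\<bar> \<le> K" using mixed_test_bounded[OF F] by blast
  have F_lim: "(\<lambda>n. \<integral>w. F (fst w / real (Suc n)) (snd w * real (Suc n)) \<partial>(\<mu> \<Otimes>\<^sub>M \<nu>))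
      \<longlonglongrightarrow> (\<integral>w. A (C f) (fst w * snd w) \<partial>(\<mu> \<Otimes>\<^sub>M \<nu>))"
  proof (rule integral_dominated_convergence[where w = "\<lambda>_. K"])
    show "AE w in \<mu> \<Otimes>\<^sub>M \<nu>. (\<lambda>n. F (fst w / real (Suc n)) (snd w * real (Suc n)))
        \<longlonglongrightarrow> A (C f) (fst w * snd w)"
      using nz_pair by eventually_elim (rule mixed_test_tendsto[OF F])
  qed (use K in \<open>auto intro!: meas[OF F] cont mixed_test_limit_C0_infinity[OF F]\<close>)
  obtain M where M: "\<And>x z. \<bar>(x * z) ^ m * H x z\<bar> \<le> M" using mixed_test_bounded[OF H] by blast
  have H_bound: "\<bar>(x * y) ^ m * H (x / real (Suc n)) (y * real (Suc n))\<bar> \<le> M" for x y n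
    using M[of "x / real (Suc n)" "y * real (Suc n)"] by simp
  have H_lim: "(\<lambda>n. \<integral>w. (fst w * snd w) ^ m * H (fst w / real (Suc n)) (snd w * real (Suc n))
        \<partial>(\<mu> \<Otimes>\<^sub>M \<nu>))
      \<longlonglongrightarrow> (\<integral>w. (fst w * snd w) ^ m * B (D f) (fst w * snd w) \<partial>(\<mu> \<Otimes>\<^sub>M \<nu>))"
  proof (rule integral_dominated_convergence[where w = "\<lambda>_. M"])
    show "AE w in \<mu> \<Otimes>\<^sub>M \<nu>.
        (\<lambda>n. (fst w * snd w) ^ m * H (fst w / real (Suc n)) (snd w * real (Suc n)))
        \<longlonglongrightarrow> (fst w * snd w) ^ m * B (D f) (fst w * snd w)"
      using nz_pair by eventually_elim (intro tendsto_mult tendsto_const mixed_test_tendsto[OF H])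
    show "AE w in \<mu> \<Otimes>\<^sub>M \<nu>.
        norm ((fst w * snd w) ^ m * H (fst w / real (Suc n)) (snd w * real (Suc n))) \<le> M" for n
      using H_bound by simp
    show "(\<lambda>w. (fst w * snd w) ^ m * B (D f) (fst w * snd w)) \<in> borel_measurable (\<mu> \<Otimes>\<^sub>M \<nu>)"
      by (rule cont[OF C0_infinity_power_mult[OF mixed_test_limit_C0_infinity[OF H]]])
  qed (auto intro!: borel_measurable_times meas[OF H])
  show ?thesis
    using LIMSEQ_unique[OF tendsto_mult[OF tendsto_const F_lim, of "a * c"]]
      tendsto_mult[OF tendsto_const H_lim, of "b * d"] step[of "real (Suc _)"] by simp
qed

section \<open>From the random variables to their laws\<close>

lemma smooth_density_AE_nonzero:
  assumes "prob_space P" "smooth_density_on_interval P X"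
  shows "AE \<omega> in P. X \<omega> \<noteq> 0"
proof -
  interpret prob_space P by fact
  obtain d where d: "distributed P lborel X (\<lambda>x. ennreal (d x))"
    using assms(2) unfolding smooth_density_on_interval_def by blast
  \<comment> \<open>A single point is Lebesgue null, hence null for any law with a Lebesgue
    density.\<close>
  have "AE x in lborel. x \<noteq> (0::real)" by (rule AE_lborel_singleton)
  then show ?thesis
    by (subst distributed_AE2[OF d]) auto
qed

text \<open>The expectation of the difference may be split because each term is a bounded test
  function of \<open>X\<close>; the result is the form that can be iterated.\<close>

lemma stein_operator_distr:
  fixes X :: "'a \<Rightarrow> real"
  assumes P: "prob_space P" "X \<in> borel_measurable P"
    and stein: "stein_operator P X
      (\<lambda>f x. a * T_op r f x - b * ((mult_op ^^ p) \<circ> T_op s) f x)"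
    and g: "g \<in> C0_infinity"
  shows "a * (\<integral>x. T_op r g x \<partial>distr P borel X) = b * (\<integral>x. x ^ p * T_op s g x \<partial>distr P borel X)"
proof -
  have T: "T_op r g \<in> C0_infinity" "(\<lambda>x. x ^ p * T_op s g x) \<in> C0_infinity"
    using g by (auto intro: C0_infinity_power_mult)
  have "(\<integral>\<omega>. a * T_op r g (X \<omega>) - b * (X \<omega> ^ p * T_op s g (X \<omega>)) \<partial>P) = 0"
    using stein g by (simp add: stein_operator_on_def mult_op_funpow)
  then have "a * (\<integral>\<omega>. T_op r g (X \<omega>) \<partial>P) = b * (\<integral>\<omega>. X \<omega> ^ p * T_op s g (X \<omega>) \<partial>P)"
    using integrable_C0_infinity[OF P T(1)] integrable_C0_infinity[OF P T(2)] by simp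
  then show ?thesis
    using T P(2) by (simp add: integral_distr C0_infinity_borel_measurable)
qed

theorem proposition2p12:
  fixes P :: "'a measure" and X Y :: "'a \<Rightarrow> real"
    and a\<^sub>1 a\<^sub>2 b\<^sub>1 b\<^sub>2 :: real
    and \<alpha>\<^sub>1 \<alpha>\<^sub>2 \<beta>\<^sub>1 \<beta>\<^sub>2 :: ereal
    and p q m k\<^sub>1 k\<^sub>2 :: nat
  assumes "prob_space P"
    and "X \<in> borel_measurable P" and "Y \<in> borel_measurable P"
    and "smooth_density_on_interval P X" and "smooth_density_on_interval P Y"
    and "p > 0" and "q > 0"
    and "\<alpha>\<^sub>1 \<noteq> -\<infinity>" and "\<alpha>\<^sub>2 \<noteq> -\<infinity>" and "\<beta>\<^sub>1 \<noteq> -\<infinity>" and "\<beta>\<^sub>2 \<noteq> -\<infinity>"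
    and "stein_operator P X
           (\<lambda>f x. a\<^sub>1 * T_op \<alpha>\<^sub>1 f x - a\<^sub>2 * ((mult_op ^^ p) \<circ> T_op \<alpha>\<^sub>2) f x)"
    and "stein_operator P Y
           (\<lambda>f x. b\<^sub>1 * T_op \<beta>\<^sub>1 f x - b\<^sub>2 * ((mult_op ^^ q) \<circ> T_op \<beta>\<^sub>2) f x)"
    and "m = lcm p q" and "m = k\<^sub>1 * p" and "m = k\<^sub>2 * q"
    and "prob_space.indep_var P borel X borel Y"
  shows "stein_operator P (\<lambda>\<omega>. X \<omega> * Y \<omega>)
           (\<lambda>f x.
              a\<^sub>1 ^ k\<^sub>1 * b\<^sub>1 ^ k\<^sub>2 *
                (op_prod k\<^sub>1 (\<lambda>i. T_op (\<alpha>\<^sub>1 + ereal (real (i * p)))) \<circ>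
                 op_prod k\<^sub>2 (\<lambda>i. T_op (\<beta>\<^sub>1 + ereal (real (i * q))))) f x
            - a\<^sub>2 ^ k\<^sub>1 * b\<^sub>2 ^ k\<^sub>2 *
                ((mult_op ^^ m) \<circ>
                 op_prod k\<^sub>1 (\<lambda>i. T_op (\<alpha>\<^sub>2 + ereal (real (i * p)))) \<circ>
                 op_prod k\<^sub>2 (\<lambda>i. T_op (\<beta>\<^sub>2 + ereal (real (i * q))))) f x)"
proof -
  interpret prob_space P by fact
  note X = assms(2) and Y = assms(3)
  let ?\<mu> = "distr P borel X" and ?\<nu> = "distr P borel Y"
  let ?A = "op_prod k\<^sub>1 (\<lambda>i. T_op (\<alpha>\<^sub>1 + ereal (real (i * p))))"
  let ?B = "op_prod k\<^sub>1 (\<lambda>i. T_op (\<alpha>\<^sub>2 + ereal (real (i * p))))"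
  let ?C = "op_prod k\<^sub>2 (\<lambda>i. T_op (\<beta>\<^sub>1 + ereal (real (i * q))))"
  let ?D = "op_prod k\<^sub>2 (\<lambda>i. T_op (\<beta>\<^sub>2 + ereal (real (i * q))))"
  have XY: "(\<lambda>\<omega>. X \<omega> * Y \<omega>) \<in> borel_measurable P"
    using X Y by simp
  \<comment> \<open>Independence enters here: the joint law is the product of the marginal
    laws.\<close>
  have pair: "?\<mu> \<Otimes>\<^sub>M ?\<nu> = distr P (borel \<Otimes>\<^sub>M borel) (\<lambda>\<omega>. (X \<omega>, Y \<omega>))"
    using assms(17) by (simp add: indep_var_distribution_eq)
  have integral_pair: "(\<integral>w. h (fst w * snd w) \<partial>(?\<mu> \<Otimes>\<^sub>M ?\<nu>)) = (\<integral>\<omega>. h (X \<omega> * Y \<omega>) \<partial>P)"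
    if "h \<in> C0_infinity" for h
  proof -
    note [measurable] = C0_infinity_borel_measurable[OF that]
    show ?thesis using X Y unfolding pair by (subst integral_distr) auto
  qed
  \<comment> \<open>Iterating \<open>k\<^sub>1\<close> times raises the weight to
    \<open>m = k\<^sub>1 * p\<close>, the power shared with the equation for
    \<open>Y\<close>.\<close>
  have stein_X: "a\<^sub>1 ^ k\<^sub>1 * (\<integral>x. ?A g x \<partial>?\<mu>) = a\<^sub>2 ^ k\<^sub>1 * (\<integral>x. x ^ m * ?B g x \<partial>?\<mu>)"
    if "g \<in> C0_infinity" for g
    unfolding \<open>m = k\<^sub>1 * p\<close>
    by (rule stein_equation_iterate[OF stein_operator_distr[OF assms(1) X assms(12)] assms(8,9) that])
  have stein_Y: "b\<^sub>1 ^ k\<^sub>2 * (\<integral>x. ?C g x \<partial>?\<nu>) = b\<^sub>2 ^ k\<^sub>2 * (\<integral>x. x ^ m * ?D g x \<partial>?\<nu>)"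
    if "g \<in> C0_infinity" for g
    unfolding \<open>m = k\<^sub>2 * q\<close>
    by (rule stein_equation_iterate[OF stein_operator_distr[OF assms(1) Y assms(13)] assms(10,11) that])
  have nz: "AE x in ?\<mu>. x \<noteq> 0" "AE y in ?\<nu>. y \<noteq> 0"
    using smooth_density_AE_nonzero[OF assms(1,4)] smooth_density_AE_nonzero[OF assms(1,5)] X Y
    by (simp_all add: AE_distr_iff)
  show ?thesis
    unfolding stein_operator_on_def
  proof
    fix f assume f: "f \<in> C0_infinity"
    \<comment> \<open>Both terms of the product operator send \<open>f\<close> to a test function,
      so integrability under the law of the product is automatic.\<close>
    have AC: "?A (?C f) \<in> C0_infinity" and BD: "(\<lambda>x. x ^ m * ?B (?D f) x) \<in> C0_infinity"
      by (intro C0_infinity_power_mult euler_operator_C0_infinity[OF euler_operator_op_prod] f)+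
    have "a\<^sub>1 ^ k\<^sub>1 * b\<^sub>1 ^ k\<^sub>2 * (\<integral>\<omega>. ?A (?C f) (X \<omega> * Y \<omega>) \<partial>P)
        = a\<^sub>2 ^ k\<^sub>1 * b\<^sub>2 ^ k\<^sub>2 * (\<integral>\<omega>. (X \<omega> * Y \<omega>) ^ m * ?B (?D f) (X \<omega> * Y \<omega>) \<partial>P)"
      using product_stein_equation[OF prob_space_distr[OF X] prob_space_distr[OF Y] sets_distr sets_distr
          nz euler_operator_op_prod euler_operator_op_prod euler_operator_op_prod
          euler_operator_op_prod stein_X stein_Y f]
      unfolding integral_pair[OF AC] integral_pair[OF BD] .
    with integrable_C0_infinity[OF assms(1) XY AC] integrable_C0_infinity[OF assms(1) XY BD]
    show "integrable P (\<lambda>\<omega>. a\<^sub>1 ^ k\<^sub>1 * b\<^sub>1 ^ k\<^sub>2 * (?A \<circ> ?C) f (X \<omega> * Y \<omega>)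
          - a\<^sub>2 ^ k\<^sub>1 * b\<^sub>2 ^ k\<^sub>2 * ((mult_op ^^ m) \<circ> ?B \<circ> ?D) f (X \<omega> * Y \<omega>)) \<and>
        (\<integral>\<omega>. a\<^sub>1 ^ k\<^sub>1 * b\<^sub>1 ^ k\<^sub>2 * (?A \<circ> ?C) f (X \<omega> * Y \<omega>)
          - a\<^sub>2 ^ k\<^sub>1 * b\<^sub>2 ^ k\<^sub>2 * ((mult_op ^^ m) \<circ> ?B \<circ> ?D) f (X \<omega> * Y \<omega>) \<partial>P) = 0"
      by (simp add: mult_op_funpow)
  qed
qed

end
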